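(* There are absolute constants $c_1 > 0$ and $c_2 > 0$ such that for all integers $n \geq 1$ and $0 \leq k \leq n$, $$c_1 \left(\frac{n}{k+1}\right)^{1/2} \leq \inf_{P}\frac{\|P^{\prime}\|_{[-1,1]}}{\|P\|_{[-1,1]}} \leq c_2 \left(\frac{n}{k+1}\right)^{1/2},$$ where the infimum is taken over all $P \in \mathcal{F}_{n,k}^c$, $P \not\equiv 0$, having at least one zero in $[-1,1]$.
   Context: $\mathcal{P}_n^c$ denotes the set of all algebraic polynomials of degree at most $n$ with complex coefficients. $D^+ := \{z \in \mathbb{C}: |z| \leq 1,\ \mathrm{Im}(z) \geq 0\}$ is the closed upper half-disk. For integers $0 \leq k \leq n$, $\mathcal{F}_{n,k}^c$ is the set of all polynomials $P \in \mathcal{P}_n^c$ having at least $n-k$ zeros in $D^+$ (zeros counted with multiplicity). For a complex-valued function $f$ defined on a set $A \subset \mathbb{C}$, $\|f\|_A := \sup_{z \in A} |f(z)|$. "Absolute constants" means that $c_1, c_2$ do not depend on $n$ and $k$. *)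

theory Defs
  imports "HOL-Analysis.Analysis" "HOL-Computational_Algebra.Polynomial"
begin

definition upper_half_disk :: "complex set" where
  "upper_half_disk = {z. cmod z \<le> 1 \<and> Im z \<ge> 0}"

text \<open>The interval \<open>[-1,1]\<close>, regarded as a subset of the complex plane.\<close>

definition unit_interval :: "complex set" where
  "unit_interval = complex_of_real ` {-1..1}"

text \<open>
  A real supremum, hence meaningful for \<open>f\<close> bounded on a nonempty \<open>A\<close>.  It is only applied to
  polynomials on the compact set \<^const>\<open>unit_interval\<close>.
\<close>

definition sup_norm :: "complex set \<Rightarrow> (complex \<Rightarrow> complex) \<Rightarrow> real" where
  "sup_norm A f = (SUP z\<in>A. cmod (f z))"

definition polys :: "nat \<Rightarrow> complex poly set" where
  "polys n = {p. degree p \<le> n}"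

text \<open>
  \<^const>\<open>proots\<close> is the multiset of zeros, each with its multiplicity.  As
  \<open>proots 0 = {#}\<close> by convention, the zero polynomial, which vanishes everywhere,
  is admitted separately.
\<close>

definition polys_zeros :: "nat \<Rightarrow> nat \<Rightarrow> complex poly set" where
  "polys_zeros n k =
     {p \<in> polys n. p = 0 \<or> size {#z \<in># proots p. z \<in> upper_half_disk#} \<ge> n - k}"

definition admissible :: "nat \<Rightarrow> nat \<Rightarrow> complex poly set" where
  "admissible n k =
     {p \<in> polys_zeros n k. p \<noteq> 0 \<and> (\<exists>z\<in>unit_interval. poly p z = 0)}"

text \<open>
  The real infimum over \<^const>\<open>admissible\<close> is a genuine one: the set is nonempty, the quotients
  are bounded below by \<open>0\<close>, and no denominator vanishes.
\<close>

lemma bdd_above_unit_interval: "bdd_above ((\<lambda>z. cmod (poly p z)) ` unit_interval)"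
proof -
  have "compact ((\<lambda>z. cmod (poly p z)) ` unit_interval)"
    unfolding unit_interval_def
    by (intro compact_continuous_image continuous_intros compact_Icc)
  then show ?thesis
    by (intro bounded_imp_bdd_above compact_imp_bounded)
qed

lemma sup_norm_nonneg: "sup_norm unit_interval (poly p) \<ge> 0"
proof -
  have "(1::complex) \<in> unit_interval"
    by (auto simp: unit_interval_def image_iff intro!: bexI[of _ 1])
  then have "cmod (poly p 1) \<le> sup_norm unit_interval (poly p)"
    unfolding sup_norm_def by (intro cSUP_upper bdd_above_unit_interval)
  then show ?thesis
    using norm_ge_zero order_trans by blast
qed

lemma sup_norm_pos:
  assumes "p \<noteq> 0"
  shows "sup_norm unit_interval (poly p) > 0"
proof -
  have "infinite unit_interval"
    by (auto simp: unit_interval_def finite_image_iff inj_on_def)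
  then have "\<not> unit_interval \<subseteq> {z. poly p z = 0}"
    using poly_roots_finite[OF assms] finite_subset by blast
  then obtain z where "z \<in> unit_interval" "poly p z \<noteq> 0"
    by blast
  then have "0 < cmod (poly p z)" "cmod (poly p z) \<le> sup_norm unit_interval (poly p)"
    unfolding sup_norm_def by (auto intro!: cSUP_upper bdd_above_unit_interval)
  then show ?thesis
    by linarith
qed

lemma admissible_nonempty:
  assumes "n \<ge> 1"
  shows "monom 1 n \<in> admissible n k"
proof -
  have "{#z \<in># proots (monom (1::complex) n). z \<in> upper_half_disk#} = replicate_mset n 0"
    by (simp add: monom_altdef proots_power multiset_eq_iff upper_half_disk_def)
  moreover have "(0::complex) \<in> unit_interval"
    by (auto simp: unit_interval_def image_iff intro!: bexI[of _ 0])
  ultimately show ?thesis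
    using assms
    by (auto simp: admissible_def polys_zeros_def polys_def degree_monom_le poly_monom
        monom_eq_0_iff zero_power intro!: bexI[of _ 0])
qed

lemma bdd_below_quotients:
  "bdd_below ((\<lambda>p. sup_norm unit_interval (poly (pderiv p)) / sup_norm unit_interval (poly p)) ` A)"
  by (intro bdd_belowI2[of _ 0] divide_nonneg_nonneg sup_norm_nonneg)

end

theory Submission
  imports Defs "HOL-Computational_Algebra.Fundamental_Theorem_Algebra"
begin

text \<open>
  Write \<open>M\<close> for the quotient \<open>\<parallel>P'\<parallel> / \<parallel>P\<parallel>\<close>.

  \<^bold>\<open>Lower bound.\<close>  Near a point where \<open>|P|\<close> is maximal, \<open>|P|\<close> stays above half its maximum on an
  interval of length \<open>\<delta> = 1 / (2M)\<close>, so \<open>P' / P = \<Sum> 1 / (x - z\<^sub>j)\<close> is of size at most \<open>1 / \<delta>\<close> there.  This sum is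
  tested against a complex measure on the interval.  After rescaling the interval to \<open>[-1,1]\<close>, the test
  measure is such that its Cauchy transform is \<open>2\<i>q + q\<^sup>2\<close> up to a constant factor, where
  \<open>z = (q + 1 / q) / 2\<close> and \<open>|q| < 1\<close>.  This function is bounded on the whole complement of the
  interval, so each of the \<open>k\<close> unrestricted zeros does only bounded harm; and in the upper half-plane its real
  part is at least \<open>|q|\<^sup>2\<close>, which is of the order of \<open>\<delta>\<^sup>2\<close> or more for a zero in the half-disk, so those zeros cannot cancel
  each other.  Hence \<open>(n - k)\<delta>\<^sup>2\<close> is at most a constant times \<open>k + 1\<close>
  (\<open>count_upper_zeros_le\<close>), which is the lower bound for \<open>M\<close> (\<open>Turan_lower_bound\<close>).
  The zero of \<open>P\<close> in \<open>[-1,1]\<close> is what keeps \<open>\<delta>\<close> from exceeding \<open>1\<close>.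

  \<^bold>\<open>Upper bound.\<close>  With \<open>y = x\<^sup>2\<close>, the polynomial \<open>(1 - y)\<^sup>m\<close> times a partial sum of the series of
  \<open>(1 - y)\<^sup>-\<^sup>m\<close> has the value \<open>1\<close> at \<open>0\<close> and \<open>m\<close>-fold zeros at both end points.  The average of these polynomials over the
  first \<open>J\<close> partial sums decreases slowly: by a telescoping identity its derivative is
  \<open>- 2x m / J\<close> times a partial sum of a negative binomial series, and estimating that sum in two ways gives the
  bound \<open>C (m / J)\<^sup>1\<^sup>/\<^sup>2\<close> (\<open>norm_pderiv_plateau_poly_le\<close>).  With \<open>m\<close> about \<open>n / 2\<close> and
  \<open>J\<close> about \<open>k / 2\<close> this is the required order (\<open>exists_small_ratio\<close>).
\<close>

section \<open>A Cauchy transform on the complement of the interval\<close>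

lemma has_integral_of_antiderivative:
  fixes F f :: "complex \<Rightarrow> complex" and a b :: real
  assumes "a \<le> b"
    and "\<And>t. a \<le> t \<Longrightarrow> t \<le> b \<Longrightarrow> (F has_field_derivative f (of_real t)) (at (of_real t))"
  shows "((\<lambda>t. f (of_real t)) has_integral (F (of_real b) - F (of_real a))) {a..b}"
  using assms
  by (intro fundamental_theorem_of_calculus)
     (auto intro!: has_vector_derivative_at_within has_vector_derivative_real_field)

lemma Poisson_denominator:
  "1 - 2 * q * cos (of_real t) + q\<^sup>2 =
     (1 - q * exp (\<i> * of_real t)) * (1 - q * inverse (exp (\<i> * of_real t)))"
proof -
  define e where "e = exp (\<i> * complex_of_real t)"
  have "e \<noteq> 0" by (simp add: e_def)
  have "cos (of_real t) = (e + inverse e) / 2"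
    by (simp add: cos_exp_eq e_def exp_minus)
  hence "1 - 2 * q * cos (of_real t) + q\<^sup>2 = 1 - 2 * q * ((e + inverse e) / 2) + q\<^sup>2" by (simp only:)
  also have "\<dots> = (1 - q * e) * (1 - q * inverse e)"
    using \<open>e \<noteq> 0\<close> by (simp add: field_simps power2_eq_square)
  finally show ?thesis unfolding e_def .
qed

text \<open>
  The Poisson kernel has mean value \<open>1\<close> for complex \<open>q\<close> as well.  Splitting it into partial fractions
  in \<open>e\<^sup>i\<^sup>t\<close> gives an explicit antiderivative; its two logarithms are of points of the right
  half-plane, and they cancel at both end points.
\<close>

lemma has_integral_Poisson:
  fixes q :: complex
  assumes q: "cmod q < 1"
  shows "((\<lambda>t. (1 - q\<^sup>2) / (1 - 2 * q * cos (of_real t) + q\<^sup>2)) has_integral of_real pi) {0..pi}"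
proof -
  define F where "F = (\<lambda>w. w + \<i> * Ln (1 - q * exp (\<i> * w)) - \<i> * Ln (1 - q * exp (-(\<i> * w))))"
  have pos: "1 - q * u \<notin> \<real>\<^sub>\<le>\<^sub>0" if "cmod u = 1" for u
  proof -
    have "Re (q * u) \<le> cmod (q * u)" by (rule complex_Re_le_cmod)
    also have "\<dots> < 1" using q that by (simp add: norm_mult)
    finally show ?thesis by (auto simp: complex_nonpos_Reals_iff)
  qed
  have "((\<lambda>t. (1 - q\<^sup>2) / (1 - 2 * q * cos (of_real t) + q\<^sup>2)) has_integral
          (F (of_real pi) - F (of_real 0))) {0..pi}"
  proof (rule has_integral_of_antiderivative)
    fix t :: real
    define e where "e = exp (\<i> * of_real t)"
    have e: "exp (-(\<i> * of_real t)) = inverse e" "e \<noteq> 0" "cmod e = 1"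
      by (simp_all add: e_def exp_minus)
    have n1: "1 - q * e \<notin> \<real>\<^sub>\<le>\<^sub>0" and n2: "1 - q * inverse e \<notin> \<real>\<^sub>\<le>\<^sub>0"
      using e by (auto intro!: pos simp: norm_inverse)
    hence z: "1 - q * e \<noteq> 0" "1 - q * inverse e \<noteq> 0"
      by (auto simp del: right_minus_eq)
    hence z': "e - q \<noteq> 0" using e by (auto simp: field_simps)
    have D: "1 - 2 * q * cos (of_real t) + q\<^sup>2 = (1 - q * e) * (1 - q * inverse e)"
      unfolding e_def by (rule Poisson_denominator)
    have d: "((\<lambda>w. 1 - q * exp (\<i> * w)) has_field_derivative (- (q * (e * \<i>)))) (at (of_real t))"
            "((\<lambda>w. 1 - q * exp (- (\<i> * w))) has_field_derivative (q * (inverse e * \<i>))) (at (of_real t))"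
      by (auto intro!: derivative_eq_intros simp: e e_def[symmetric])
    have L: "((\<lambda>w. Ln (1 - q * exp (\<i> * w))) has_field_derivative
               (inverse (1 - q * e) * (- (q * (e * \<i>))))) (at (of_real t))"
            "((\<lambda>w. Ln (1 - q * exp (- (\<i> * w)))) has_field_derivative
               (inverse (1 - q * inverse e) * (q * (inverse e * \<i>)))) (at (of_real t))"
      using DERIV_chain2[OF _ d(1), of Ln] DERIV_chain2[OF _ d(2), of Ln]
        has_field_derivative_Ln[OF n1] has_field_derivative_Ln[OF n2]
      by (simp_all only: e(1) e_def[symmetric])
    have "(F has_field_derivative
             (1 + \<i> * (inverse (1 - q * e) * (- (q * (e * \<i>)))) -
              \<i> * (inverse (1 - q * inverse e) * (q * (inverse e * \<i>))))) (at (of_real t))"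
      unfolding F_def by (intro DERIV_diff DERIV_add DERIV_cmult DERIV_ident L)
    also have "1 + \<i> * (inverse (1 - q * e) * (- (q * (e * \<i>)))) -
                 \<i> * (inverse (1 - q * inverse e) * (q * (inverse e * \<i>))) =
               1 + q * e / (1 - q * e) + q * inverse e / (1 - q * inverse e)"
      by (simp add: divide_inverse mult_ac)
    also have "1 + q * e / (1 - q * e) + q * inverse e / (1 - q * inverse e) =
               (1 - q\<^sup>2) / (1 - 2 * q * cos (of_real t) + q\<^sup>2)"
      unfolding D using z z' e(2) by (simp add: divide_simps) (simp add: algebra_simps power2_eq_square)
    finally show "(F has_field_derivative (1 - q\<^sup>2) / (1 - 2 * q * cos (of_real t) + q\<^sup>2)) (at (of_real t))" .
  qed auto
  also have "F (of_real pi) - F (of_real 0) = of_real pi"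
    by (simp add: F_def exp_minus mult.commute[of \<i>])
  finally show ?thesis .
qed

text \<open>
  The Joukowski map sends the punctured open disk onto the complement of \<open>[-1,1]\<close>: the two
  preimages of \<open>z\<close> are the roots of \<open>q\<^sup>2 - 2zq + 1\<close>, whose product is \<open>1\<close>, and if both were
  on the unit circle, then \<open>z\<close> would be the real part of one of them.
\<close>

lemma joukowski_preimage:
  fixes z :: complex
  assumes "z \<notin> unit_interval"
  obtains q where "q \<noteq> 0" "cmod q < 1" "z = (q + 1 / q) / 2"
proof -
  define s where "s = csqrt (z\<^sup>2 - 1)"
  have prod: "(z - s) * (z + s) = 1"
    by (simp add: s_def algebra_simps flip: power2_eq_square)
  hence n0: "z - s \<noteq> 0" "z + s \<noteq> 0" by auto
  have inv: "1 / (z - s) = z + s" "1 / (z + s) = z - s"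
    using prod n0 by (auto simp: field_simps)
  have "cmod (z - s) \<noteq> 1"
  proof
    assume c: "cmod (z - s) = 1"
    have "z + s = cnj (z - s)"
      using inv(1) c by (simp add: divide_conv_cnj del: complex_cnj_diff)
    hence "z = of_real (Re (z - s))" by (auto simp: complex_eq_iff)
    moreover have "\<bar>Re (z - s)\<bar> \<le> 1" using abs_Re_le_cmod[of "z - s"] c by simp
    ultimately show False
      using assms unfolding unit_interval_def by (metis abs_le_iff atLeastAtMost_iff image_eqI minus_le_iff)
  qed
  moreover have "cmod (z - s) * cmod (z + s) = 1"
    by (metis norm_mult norm_one prod)
  ultimately consider "cmod (z - s) < 1" | "cmod (z + s) < 1"
    using mult_le_cancel_left1[of "cmod (z - s)" "cmod (z + s)"] n0 by force
  then show thesis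
    by cases (use that[of "z - s"] that[of "z + s"] n0 inv in auto)
qed

text \<open>
  The density of the test measure under \<open>x = cos t\<close>: the factor \<open>sin\<^sup>2 t\<close> consists of the semicircle
  density and of \<open>dx = - sin t dt\<close>, and \<open>1\<close> and \<open>2 cos t\<close> are the first two
  Chebyshev polynomials of the second kind.  The coefficient \<open>2\<i>\<close> is large enough for
  \<open>2 Im (1 / w) \<le> Re (1 / w\<^sup>2)\<close> not to fail badly in the upper half-plane; see below.
\<close>

definition weight :: "real \<Rightarrow> complex" where
  "weight t = of_real ((sin t)\<^sup>2) * (2 * \<i> + 2 * of_real (cos t))"

lemma norm_weight_le: "cmod (weight t) \<le> 3"
proof -
  have "cmod (2 * \<i> + 2 * of_real (cos t)) = sqrt (4 + 4 * (cos t)\<^sup>2)"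
    by (simp add: cmod_def power_mult_distrib)
  also have "\<dots> \<le> sqrt (3\<^sup>2)"
    by (intro real_sqrt_le_mono) (use abs_cos_le_one[of t] in \<open>simp flip: abs_square_le_1\<close>)
  finally have "cmod (2 * \<i> + 2 * of_real (cos t)) \<le> 3" by simp
  moreover have "\<bar>(sin t)\<^sup>2\<bar> \<le> 1" by (simp add: abs_square_le_1)
  ultimately have "\<bar>(sin t)\<^sup>2\<bar> * cmod (2 * \<i> + 2 * of_real (cos t)) \<le> 1 * 3"
    by (intro mult_mono) auto
  thus ?thesis by (simp add: weight_def norm_mult del: of_real_power)
qed

text \<open>
  The Chebyshev polynomials \<open>U\<^sub>0\<close> and \<open>U\<^sub>1\<close>, weighted by the semicircle density, have the Cauchy
  transforms \<open>q\<close> and \<open>q\<^sup>2\<close> up to a constant factor.  Since the weight is a polynomial in \<open>cos t\<close>,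
  division by \<open>cos t - z\<close> leaves a trigonometric polynomial and a multiple of the Poisson kernel.
\<close>

lemma has_integral_weight:
  fixes q :: complex
  assumes q: "q \<noteq> 0" "cmod q < 1" and z: "z = (q + 1 / q) / 2"
  shows "((\<lambda>t. weight t / (of_real (cos t) - z)) has_integral (- of_real pi * (2 * \<i> * q + q\<^sup>2))) {0..pi}"
proof -
  define K where "K = (\<lambda>t::real. (1 - q\<^sup>2) / (1 - 2 * q * cos (of_real t) + q\<^sup>2))"
  have K: "(K has_integral of_real pi) {0..pi}"
    unfolding K_def by (rule has_integral_Poisson) fact
  have "((\<lambda>t. cos (of_real t) :: complex) has_integral (sin (of_real pi) - sin (of_real 0))) {0..pi}"
    by (rule has_integral_of_antiderivative) (auto intro!: derivative_eq_intros)
  hence c1: "((\<lambda>t. cos (of_real t) :: complex) has_integral 0) {0..pi}"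
    by (simp add: sin_of_real)
  define G :: "complex \<Rightarrow> complex" where "G = (\<lambda>w. (w + sin w * cos w) / 2)"
  have "((\<lambda>t. (cos (of_real t))\<^sup>2 :: complex) has_integral (G (of_real pi) - G (of_real 0))) {0..pi}"
    unfolding G_def
  proof (rule has_integral_of_antiderivative)
    fix t :: real
    have s: "sin (of_real t :: complex) * sin (of_real t) = 1 - cos (of_real t) * cos (of_real t)"
      using sin_squared_eq[of "of_real t :: complex"] by (simp add: power2_eq_square)
    show "((\<lambda>w. (w + sin w * cos w) / 2) has_field_derivative (cos (of_real t :: complex))\<^sup>2) (at (of_real t))"
      by (auto intro!: derivative_eq_intros simp: power2_eq_square s)
  qed auto
  hence c2: "((\<lambda>t. (cos (of_real t))\<^sup>2 :: complex) has_integral (of_real pi / 2)) {0..pi}"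
    by (simp add: G_def sin_of_real)
  have cst: "((\<lambda>t. 2 - 2 * \<i> * z - 2 * z\<^sup>2) has_integral (of_real pi * (2 - 2 * \<i> * z - 2 * z\<^sup>2))) {0..pi}"
    using has_integral_const_real[of "2 - 2 * \<i> * z - 2 * z\<^sup>2" 0 pi] by (simp add: scaleR_conv_of_real)
  \<comment> \<open>The quotient and the remainder of the division by \<open>cos t - z\<close>, the latter
    written with the Poisson kernel.\<close>
  define H where "H = (\<lambda>t::real. (2 - 2 * \<i> * z - 2 * z\<^sup>2) + (- 2 * \<i> - 2 * z) * cos (of_real t) +
                       (- 2) * (cos (of_real t))\<^sup>2 + (z - q) * (2 * \<i> + 2 * z) * K t)"
  have "(H has_integral (of_real pi * (2 - 2 * \<i> * z - 2 * z\<^sup>2) + (- 2 * \<i> - 2 * z) * 0 +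
                       (- 2) * (of_real pi / 2) + (z - q) * (2 * \<i> + 2 * z) * of_real pi)) {0..pi}"
    unfolding H_def by (intro has_integral_add has_integral_mult_right K c1 c2 cst)
  also have "(of_real pi * (2 - 2 * \<i> * z - 2 * z\<^sup>2) + (- 2 * \<i> - 2 * z) * 0 +
                       (- 2) * (of_real pi / 2) + (z - q) * (2 * \<i> + 2 * z) * of_real pi) =
             of_real pi * (1 - 2 * \<i> * q - 2 * (z * q))"
    by (simp add: algebra_simps power2_eq_square)
  also have "z * q = (q\<^sup>2 + 1) / 2"
    using q by (simp add: z field_simps power2_eq_square)
  also have "of_real pi * (1 - 2 * \<i> * q - 2 * ((q\<^sup>2 + 1) / 2)) = - of_real pi * (2 * \<i> * q + q\<^sup>2)"
    by (simp add: field_simps)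
  finally have "(H has_integral (- of_real pi * (2 * \<i> * q + q\<^sup>2))) {0..pi}" .
  moreover have "H t = weight t / (of_real (cos t) - z)" for t
  proof -
    define c :: complex where "c = cos (of_real t)"
    define D where "D = 1 - 2 * q * c + q\<^sup>2"
    have c_eq: "complex_of_real (cos t) = c" by (simp add: c_def cos_of_real)
    have s: "complex_of_real ((sin t)\<^sup>2) = 1 - c\<^sup>2"
      unfolding c_eq[symmetric] by (simp add: sin_squared_eq)
    have D: "c - z = - D / (2 * q)"
      using q by (simp add: D_def z field_simps power2_eq_square)
    have "D \<noteq> 0"
    proof
      assume "D = 0"
      define e where "e = exp (\<i> * of_real t)"
      have e: "e \<noteq> 0" "cmod e = 1" by (simp_all add: e_def)
      have "D = (1 - q * e) * (1 - q * inverse e)"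
        unfolding D_def c_def e_def by (rule Poisson_denominator)
      hence "q * e = 1 \<or> q * inverse e = 1" using \<open>D = 0\<close> by auto
      hence "cmod q = 1" using e(2) by (metis mult.right_neutral norm_inverse norm_mult norm_one inverse_1)
      thus False using q by simp
    qed
    have zz: "1 - z\<^sup>2 = - ((1 - q\<^sup>2)\<^sup>2 / (4 * q\<^sup>2))"
      using q by (simp add: z field_simps power2_eq_square)
    have zq: "z - q = (1 - q\<^sup>2) / (2 * q)"
      using q by (simp add: z field_simps power2_eq_square)
    have Kt: "(z - q) * K t * (c - z) = 1 - z\<^sup>2"
      unfolding zz zq D K_def c_def[symmetric] D_def[symmetric]
      using q \<open>D \<noteq> 0\<close> by (simp add: field_simps power2_eq_square)
    have "H t * (c - z) = ((2 - 2 * \<i> * z - 2 * z\<^sup>2) + (- 2 * \<i> - 2 * z) * c +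
                       (- 2) * c\<^sup>2) * (c - z) + (2 * \<i> + 2 * z) * ((z - q) * K t * (c - z))"
      unfolding H_def c_def[symmetric] by (simp add: algebra_simps)
    also have "\<dots> = (1 - c\<^sup>2) * (2 * \<i> + 2 * c)"
      unfolding Kt by (simp add: algebra_simps power2_eq_square)
    finally have "H t * (c - z) = weight t" unfolding weight_def s c_eq .
    moreover have "c - z \<noteq> 0" using D q \<open>D \<noteq> 0\<close> by simp
    ultimately show ?thesis by (simp add: c_eq field_simps)
  qed
  ultimately show ?thesis by (simp cong: has_integral_cong)
qed

definition pairing :: "complex \<Rightarrow> complex" where
  "pairing z = integral {0..pi} (\<lambda>t. weight t / (of_real (cos t) - z))"

text \<open>
  With \<open>q\<close> the Joukowski preimage of \<open>z\<close>, the pairing is \<open>-\<pi>(2\<i>q + q\<^sup>2)\<close>, which is bounded because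
  \<open>|q| < 1\<close>, however close \<open>z\<close> is to the interval.  If \<open>Im z \<ge> 0\<close>, then \<open>t = -Im q\<close> is in \<open>[0,1]\<close> and
  \<open>Re (2\<i>q + q\<^sup>2) = |q|\<^sup>2 + 2t(1 - t) \<ge> |q|\<^sup>2\<close>, while \<open>1 / q = 2z - q\<close> shows that \<open>|q|\<close> is not small.
\<close>

lemma
  assumes "z \<notin> unit_interval"
  shows has_integral_pairing:
      "((\<lambda>t. weight t / (of_real (cos t) - z)) has_integral pairing z) {0..pi}"
    and Re_pairing_le: "Re (pairing z) \<le> 3 * pi"
    and Re_pairing_upper_half_plane: "Im z \<ge> 0 \<Longrightarrow> Re (pairing z) \<le> - pi / (2 * cmod z + 1)\<^sup>2"
proof -
  from joukowski_preimage[OF assms] obtain q where q: "q \<noteq> 0" "cmod q < 1" "z = (q + 1 / q) / 2" .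
  note I = has_integral_weight[OF q]
  show I': "((\<lambda>t. weight t / (of_real (cos t) - z)) has_integral pairing z) {0..pi}"
    unfolding pairing_def using I by (simp add: has_integral_integrable_integral integrable_integral)
  have V: "pairing z = - of_real pi * (2 * \<i> * q + q\<^sup>2)"
    using I by (simp add: pairing_def integral_unique)
  have "- Re (2 * \<i> * q + q\<^sup>2) \<le> cmod (2 * \<i> * q + q\<^sup>2)"
    using abs_Re_le_cmod[of "2 * \<i> * q + q\<^sup>2"] by linarith
  also have "\<dots> \<le> 2 * cmod q + (cmod q)\<^sup>2"
    by (rule order_trans[OF norm_triangle_ineq]) (simp add: norm_mult norm_power)
  also have "\<dots> \<le> 2 * 1 + 1\<^sup>2"
    using q by (intro add_mono mult_left_mono power_mono) auto
  finally have "pi * (- Re (2 * \<i> * q + q\<^sup>2)) \<le> pi * 3" by (intro mult_left_mono) auto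
  moreover have "Re (pairing z) = pi * (- Re (2 * \<i> * q + q\<^sup>2))"
    by (simp add: V algebra_simps)
  ultimately show "Re (pairing z) \<le> 3 * pi" by linarith
  assume "Im z \<ge> 0"
  define t where "t = - Im q"
  have cq: "0 < (cmod q)\<^sup>2" "(cmod q)\<^sup>2 < 1"
    using q by (auto simp: power_less_one_iff abs_square_less_1)
  have "Im (1 / q) = t / (cmod q)\<^sup>2"
    by (simp add: Im_divide cmod_power2 t_def)
  moreover have "2 * Im z = Im (1 / q) - t"
    by (simp add: q(3) t_def)
  ultimately have "2 * Im z = t * (1 / (cmod q)\<^sup>2 - 1)"
    by (simp add: algebra_simps)
  hence "0 \<le> t * (1 / (cmod q)\<^sup>2 - 1)" using \<open>Im z \<ge> 0\<close> by linarith
  moreover have "1 / (cmod q)\<^sup>2 - 1 > 0" using cq by (simp add: field_simps)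
  ultimately have "t \<ge> 0" by (simp add: zero_le_mult_iff)
  moreover have "t \<le> 1" using abs_Im_le_cmod[of q] q by (simp add: t_def)
  ultimately have "t * t \<le> t * 1" by (intro mult_left_mono)
  have "Re (2 * \<i> * q + q\<^sup>2) = 2 * t + (Re q)\<^sup>2 - (Im q)\<^sup>2"
    by (simp add: t_def power2_eq_square)
  also have "\<dots> = (cmod q)\<^sup>2 + 2 * t - 2 * (t * t)"
    using cmod_power2[of q] by (simp add: t_def power2_eq_square)
  finally have 1: "(cmod q)\<^sup>2 \<le> Re (2 * \<i> * q + q\<^sup>2)" using \<open>t * t \<le> t * 1\<close> by linarith
  have "1 / (2 * cmod z + 1) \<le> cmod q"
  proof -
    have "cmod (1 / q) = cmod (2 * z - q)" by (simp add: q(3) field_simps)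
    also have "\<dots> \<le> 2 * cmod z + 1"
      by (rule order_trans[OF norm_triangle_ineq4]) (use q in \<open>simp add: norm_mult\<close>)
    finally have "1 \<le> cmod q * (2 * cmod z + 1)"
      using q(1) by (simp add: norm_divide pos_divide_le_eq mult.commute)
    thus ?thesis by (subst pos_divide_le_eq) (auto simp: add_nonneg_pos)
  qed
  hence "(1 / (2 * cmod z + 1))\<^sup>2 \<le> (cmod q)\<^sup>2" by (intro power_mono) auto
  hence "pi * (1 / (2 * cmod z + 1))\<^sup>2 \<le> pi * Re (2 * \<i> * q + q\<^sup>2)"
    by (rule mult_left_mono[OF order_trans[OF _ 1]]) simp
  thus "Re (pairing z) \<le> - pi / (2 * cmod z + 1)\<^sup>2" by (simp add: V power_divide)
qed

section \<open>Counting zeros by the logarithmic derivative\<close>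

lemma log_derivative_eq_sum_proots:
  fixes p :: "complex poly"
  assumes "poly p x \<noteq> 0"
  shows "poly (pderiv p) x / poly p x = (\<Sum>z\<in>#proots p. 1 / (x - z))"
proof -
  have "poly (pderiv (\<Prod>z\<in>#M. [:-z, 1:])) x = poly (\<Prod>z\<in>#M. [:-z, 1:]) x * (\<Sum>z\<in>#M. 1 / (x - z))"
    if "x \<notin># M" for M :: "complex multiset"
    using that
    by (induction M) (auto simp: pderiv_mult pderiv_pCons field_simps simp del: mult_pCons_left mult_pCons_right)
  moreover have "x \<notin># proots p" using assms by (cases "p = 0") (auto simp: set_count_proots)
  moreover have "p = smult (lead_coeff p) (\<Prod>z\<in>#proots p. [:-z, 1:])"
    by (simp add: complex_poly_decompose_multiset)
  ultimately show ?thesis using assms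
    by (metis (no_types, lifting) mult.assoc nonzero_mult_div_cancel_left pderiv_smult poly_smult)
qed

lemma has_integral_sum_mset:
  fixes f :: "'b \<Rightarrow> real \<Rightarrow> 'a :: real_normed_vector"
  assumes "\<And>z. z \<in># M \<Longrightarrow> (f z has_integral g z) S"
  shows "((\<lambda>t. \<Sum>z\<in>#M. f z t) has_integral (\<Sum>z\<in>#M. g z)) S"
  using assms by (induction M) (auto intro!: has_integral_add)

text \<open>
  On \<open>[\<alpha> - h, \<alpha> + h]\<close>, rescaled to \<open>[-1,1]\<close>, the logarithmic derivative is a sum over the zeros, so
  its integral against the weight is the sum of the pairings.  The bound on \<open>h p' / p\<close> makes the real
  part of the integral at least \<open>-3\<pi>s\<close>.  Each zero in the half-disk contributes at most \<open>-\<pi> / (4/h + 1)\<^sup>2\<close>, since it is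
  at distance at most \<open>2/h\<close> from the centre after rescaling, and each of the at most \<open>k\<close> others
  contributes at most \<open>3\<pi>\<close>, wherever it is.
\<close>

lemma count_upper_zeros_le:
  fixes p :: "complex poly" and \<alpha> h s :: real
  assumes "degree p \<le> n" "k \<le> n"
    and zeros: "n - k \<le> size {#z \<in># proots p. z \<in> upper_half_disk#}"
    and h: "h > 0" "{\<alpha>-h..\<alpha>+h} \<subseteq> {-1..1}" and s: "s \<ge> 0"
    and nonzero: "\<And>x. x \<in> {\<alpha>-h..\<alpha>+h} \<Longrightarrow> poly p (of_real x) \<noteq> 0"
    and bound: "\<And>x. x \<in> {\<alpha>-h..\<alpha>+h} \<Longrightarrow>
                  h * cmod (poly (pderiv p) (of_real x)) \<le> s * cmod (poly p (of_real x))"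
  shows "real n - real k \<le> 3 * (real k + s) * (4 / h + 1)\<^sup>2"
proof -
  define \<zeta> :: "complex \<Rightarrow> complex" where "\<zeta> = (\<lambda>z. (z - of_real \<alpha>) / of_real h)"
  have in_I: "\<alpha> + h * u \<in> {\<alpha>-h..\<alpha>+h}" if "u \<in> {-1..1}" for u
    using that h(1) mult_left_mono[of u 1 h] mult_left_mono[of "-1" u h] by auto
  have p0: "p \<noteq> 0" using nonzero[of \<alpha>] h(1) by auto
  have off: "\<zeta> z \<notin> unit_interval" if z: "z \<in># proots p" for z
  proof
    assume "\<zeta> z \<in> unit_interval"
    then obtain u where u: "u \<in> {-1..1}" "\<zeta> z = of_real u" by (auto simp: unit_interval_def)
    hence "z = of_real (\<alpha> + h * u)" using h(1) by (simp add: \<zeta>_def field_simps)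
    moreover have "poly p z = 0" using z p0 by (simp add: set_count_proots)
    ultimately show False using nonzero[OF in_I[OF u(1)]] by simp
  qed
  define g where "g = (\<lambda>t. weight t * (of_real h *
     (poly (pderiv p) (of_real (\<alpha> + h * cos t)) / poly p (of_real (\<alpha> + h * cos t)))))"
  have "((\<lambda>t. \<Sum>z\<in>#proots p. weight t / (of_real (cos t) - \<zeta> z)) has_integral
          (\<Sum>z\<in>#proots p. pairing (\<zeta> z))) {0..pi}"
    by (intro has_integral_sum_mset has_integral_pairing off)
  moreover have "(\<Sum>z\<in>#proots p. weight t / (of_real (cos t) - \<zeta> z)) = g t" for t
  proof -
    define x :: complex where "x = of_real (\<alpha> + h * cos t)"
    have "poly p x \<noteq> 0" unfolding x_def by (intro nonzero in_I) auto
    hence "poly (pderiv p) x / poly p x = (\<Sum>z\<in>#proots p. 1 / (x - z))"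
      by (rule log_derivative_eq_sum_proots)
    hence "g t = weight t * (of_real h * (\<Sum>z\<in>#proots p. 1 / (x - z)))"
      by (simp only: g_def x_def)
    also have "\<dots> = (\<Sum>z\<in>#proots p. weight t * (of_real h * (1 / (x - z))))"
      by (simp add: sum_mset_distrib_left)
    also have "\<dots> = (\<Sum>z\<in>#proots p. weight t / (of_real (cos t) - \<zeta> z))"
    proof (intro arg_cong[where f = sum_mset] image_mset_cong)
      fix z
      have "of_real (cos t) - \<zeta> z = (x - z) / of_real h"
        using h(1) by (simp add: \<zeta>_def x_def field_simps)
      thus "weight t * (of_real h * (1 / (x - z))) = weight t / (of_real (cos t) - \<zeta> z)"
        by simp
    qed
    finally show ?thesis ..
  qed
  ultimately have I: "(g has_integral (\<Sum>z\<in>#proots p. pairing (\<zeta> z))) {0..pi}" by simp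
  have "cmod (g t) \<le> 3 * s" for t
  proof -
    define x :: complex where "x = of_real (\<alpha> + h * cos t)"
    have x: "poly p x \<noteq> 0" "h * cmod (poly (pderiv p) x) \<le> s * cmod (poly p x)"
      unfolding x_def by (intro nonzero bound in_I; simp)+
    have "cmod (g t) = cmod (weight t) * (h * cmod (poly (pderiv p) x) / cmod (poly p x))"
      unfolding g_def x_def[symmetric] using h(1) by (simp add: norm_mult norm_divide)
    also have "\<dots> \<le> 3 * s"
      using x h(1) s by (intro mult_mono norm_weight_le) (auto simp: pos_divide_le_eq)
    finally show ?thesis .
  qed
  hence "cmod (\<Sum>z\<in>#proots p. pairing (\<zeta> z)) \<le> 3 * s * pi"
    using has_integral_bound_real[OF _ finite.emptyI I, of "3 * s"] s by simp
  hence lower: "- (3 * s * pi) \<le> Re (\<Sum>z\<in>#proots p. pairing (\<zeta> z))"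
    using abs_Re_le_cmod[of "\<Sum>z\<in>#proots p. pairing (\<zeta> z)"] by linarith
  define A where "A = {#z \<in># proots p. z \<in> upper_half_disk#}"
  define B where "B = {#z \<in># proots p. z \<notin> upper_half_disk#}"
  have AB: "proots p = A + B" by (simp add: A_def B_def)
  define R where "R = 4 / h + 1"
  have "R > 0" using h(1) by (simp add: R_def add_pos_pos)
  have Re_sum: "Re (\<Sum>z\<in>#M. pairing (\<zeta> z)) = (\<Sum>z\<in>#M. Re (pairing (\<zeta> z)))" for M
    by (induction M) auto
  have "(\<Sum>z\<in>#A. Re (pairing (\<zeta> z))) \<le> (\<Sum>z\<in>#A. - pi / R\<^sup>2)"
  proof (rule sum_mset_mono)
    fix z assume "z \<in># A"
    hence z: "z \<in># proots p" "cmod z \<le> 1" "Im z \<ge> 0"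
      by (auto simp: A_def upper_half_disk_def)
    have "cmod (z - of_real \<alpha>) \<le> 2"
      using norm_triangle_ineq4[of z "of_real \<alpha>"] z(2) h by (auto simp: norm_of_real)
    hence "cmod (\<zeta> z) \<le> 2 / h"
      using h(1) by (simp add: \<zeta>_def norm_divide divide_right_mono)
    hence "2 * cmod (\<zeta> z) + 1 \<le> R" by (simp add: R_def)
    hence "(2 * cmod (\<zeta> z) + 1)\<^sup>2 \<le> R\<^sup>2" by (intro power_mono) auto
    moreover have "0 < (2 * cmod (\<zeta> z) + 1)\<^sup>2"
      using norm_ge_zero[of "\<zeta> z"] by (intro zero_less_power) linarith
    ultimately have "pi / R\<^sup>2 \<le> pi / (2 * cmod (\<zeta> z) + 1)\<^sup>2"
      by (intro divide_left_mono) (use \<open>R > 0\<close> in auto)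
    moreover have "Im (\<zeta> z) \<ge> 0" using z(3) h(1) by (simp add: \<zeta>_def)
    ultimately show "Re (pairing (\<zeta> z)) \<le> - pi / R\<^sup>2"
      using Re_pairing_upper_half_plane[OF off[OF z(1)]] by linarith
  qed
  moreover have "(\<Sum>z\<in>#B. Re (pairing (\<zeta> z))) \<le> (\<Sum>z\<in>#B. 3 * pi)"
    by (intro sum_mset_mono Re_pairing_le off) (auto simp: AB)
  ultimately have "- (3 * s * pi) \<le> real (size A) * (- pi / R\<^sup>2) + real (size B) * (3 * pi)"
    using lower unfolding AB by (simp add: Re_sum)
  hence "pi * (real (size A) / R\<^sup>2) \<le> pi * (3 * (real (size B) + s))"
    by (simp add: algebra_simps)
  hence "real (size A) / R\<^sup>2 \<le> 3 * (real (size B) + s)"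
    by (rule mult_left_le_imp_le) simp
  hence "real (size A) \<le> 3 * (real (size B) + s) * R\<^sup>2"
    using \<open>R > 0\<close> by (simp add: pos_divide_le_eq)
  moreover have "size A + size B \<le> n"
    using assms(1) size_proots_complex[of p] by (simp add: AB)
  hence "size B \<le> k" "n \<le> size A + k" using zeros assms(2) by (auto simp: A_def[symmetric])
  moreover from this have "3 * (real (size B) + s) * R\<^sup>2 \<le> 3 * (real k + s) * R\<^sup>2"
    by (intro mult_right_mono) auto
  ultimately show ?thesis by (simp add: R_def)
qed

section \<open>The lower bound\<close>

lemma norm_le_sup_norm: "z \<in> unit_interval \<Longrightarrow> cmod (poly p z) \<le> sup_norm unit_interval (poly p)"
  unfolding sup_norm_def by (intro cSUP_upper bdd_above_unit_interval)

lemma sup_norm_attained: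
  obtains x where "x \<in> {-1..1}" "sup_norm unit_interval (poly p) = cmod (poly p (of_real x))"
proof -
  have "\<exists>x\<in>{-1..1::real}. \<forall>y\<in>{-1..1}. cmod (poly p (of_real y)) \<le> cmod (poly p (of_real x))"
    by (intro continuous_attains_sup compact_Icc continuous_intros) auto
  then obtain x where x: "x \<in> {-1..1}" "\<And>y. y \<in> {-1..1} \<Longrightarrow> cmod (poly p (of_real y)) \<le> cmod (poly p (of_real x))"
    by blast
  have "sup_norm unit_interval (poly p) = cmod (poly p (of_real x))"
    unfolding sup_norm_def unit_interval_def
    by (rule cSup_eq_maximum) (use x in auto)
  with x(1) show thesis by (rule that)
qed

lemma poly_lipschitz_unit_interval:
  assumes "x \<in> {-1..1}" "y \<in> {-1..1}"
  shows "cmod (poly p (of_real x) - poly p (of_real y)) \<le> sup_norm unit_interval (poly (pderiv p)) * \<bar>x - y\<bar>"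
proof -
  have "convex unit_interval"
    unfolding unit_interval_def by (intro convex_linear_image) (auto intro: bounded_linear.linear bounded_linear_of_real)
  hence "cmod (poly p (of_real x) - poly p (of_real y)) \<le>
          sup_norm unit_interval (poly (pderiv p)) * cmod (of_real x - of_real y)"
    by (rule field_differentiable_bound[where f' = "poly (pderiv p)"])
       (use assms in \<open>auto intro: norm_le_sup_norm has_field_derivative_at_within poly_DERIV
        simp: unit_interval_def[THEN equalityD2, THEN subsetD] imageI\<close>)
  thus ?thesis by (simp flip: of_real_diff)
qed

text \<open>
  Let \<open>M\<close> be the quotient of the norms.  Around a point where \<open>|p|\<close> is maximal there is an interval of length
  \<open>1/(2M)\<close> on which \<open>|p|\<close> is at least half its maximum, and there the logarithmic derivative is at
  most \<open>2M\<close>.  Counting zeros on this interval gives \<open>n - k \<le> C(k + 1)M\<^sup>2\<close>.  The zero of \<open>p\<close> in \<open>[-1,1]\<close>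
  forces \<open>M \<ge> 1/2\<close>, so that the interval fits into \<open>[-1,1]\<close> and \<open>k\<close> itself is at most \<open>4kM\<^sup>2\<close>.
\<close>

lemma Turan_lower_bound:
  assumes p: "p \<in> admissible n k" and "k \<le> n"
  shows "1 / 32 * sqrt (real n / (real k + 1)) \<le>
           sup_norm unit_interval (poly (pderiv p)) / sup_norm unit_interval (poly p)"
proof -
  define A where "A = sup_norm unit_interval (poly (pderiv p))"
  define B where "B = sup_norm unit_interval (poly p)"
  define M where "M = A / B"
  have "p \<noteq> 0" "degree p \<le> n"
    and zeros: "n - k \<le> size {#z \<in># proots p. z \<in> upper_half_disk#}"
    and "\<exists>z\<in>unit_interval. poly p z = 0"
    using p by (auto simp: admissible_def polys_zeros_def polys_def)
  then obtain x1 where x1: "x1 \<in> {-1..1}" "poly p (of_real x1) = 0"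
    by (auto simp: unit_interval_def)
  have "B > 0" unfolding B_def using \<open>p \<noteq> 0\<close> by (rule sup_norm_pos)
  obtain x0 where x0: "x0 \<in> {-1..1}" "B = cmod (poly p (of_real x0))"
    unfolding B_def by (rule sup_norm_attained)
  have "A \<ge> 0" unfolding A_def by (rule sup_norm_nonneg)
  have "B \<le> A * \<bar>x0 - x1\<bar>"
    using poly_lipschitz_unit_interval[OF x0(1) x1(1), of p] x0 x1 by (simp add: A_def)
  also have "\<dots> \<le> A * 2" using x0 x1 \<open>A \<ge> 0\<close> by (intro mult_left_mono) auto
  finally have "B \<le> A * 2" .
  hence M: "M \<ge> 1 / 2" using \<open>B > 0\<close> by (simp add: M_def field_simps)
  have A: "A = M * B" using \<open>B > 0\<close> by (simp add: M_def)
  define h where "h = 1 / (4 * M)"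
  \<comment> \<open>The interval has \<open>x0\<close> as an end point and extends towards the origin, so it stays in \<open>[-1,1]\<close>.\<close>
  define \<alpha> where "\<alpha> = (if x0 \<ge> 0 then x0 - h else x0 + h)"
  have h: "0 < h" "h \<le> 1 / 2" "h * M = 1 / 4" using M by (auto simp: h_def field_simps)
  have I: "{\<alpha>-h..\<alpha>+h} \<subseteq> {-1..1}" using x0 h by (auto simp: \<alpha>_def)
  have low: "B / 2 \<le> cmod (poly p (of_real x))" if "x \<in> {\<alpha>-h..\<alpha>+h}" for x
  proof -
    have "cmod (poly p (of_real x0) - poly p (of_real x)) \<le> A * \<bar>x0 - x\<bar>"
      unfolding A_def using I that x0 by (intro poly_lipschitz_unit_interval) auto
    also have "\<dots> \<le> A * (2 * h)"
      using that \<open>A \<ge> 0\<close> by (intro mult_left_mono) (auto simp: \<alpha>_def split: if_splits)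
    also have "\<dots> = 2 * B * (h * M)" by (simp add: A)
    also have "\<dots> = B / 2" by (simp add: h)
    finally show ?thesis
      using norm_triangle_ineq2[of "poly p (of_real x0)" "poly p (of_real x)"] x0(2) by linarith
  qed
  have "real n - real k \<le> 3 * (real k + 1 / 2) * (4 / h + 1)\<^sup>2"
  proof (rule count_upper_zeros_le[OF \<open>degree p \<le> n\<close> \<open>k \<le> n\<close> zeros h(1) I])
    fix x assume x: "x \<in> {\<alpha>-h..\<alpha>+h}"
    show "poly p (of_real x) \<noteq> 0" using low[OF x] \<open>B > 0\<close> by auto
    have "cmod (poly (pderiv p) (of_real x)) \<le> A"
      unfolding A_def using I x by (intro norm_le_sup_norm) (auto simp: unit_interval_def)
    hence "h * cmod (poly (pderiv p) (of_real x)) \<le> h * A" using h by (intro mult_left_mono) auto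
    also have "h * A = B * (h * M)" by (simp add: A)
    also have "\<dots> = 1 / 2 * (B / 2)" by (simp add: h)
    also have "\<dots> \<le> 1 / 2 * cmod (poly p (of_real x))" using low[OF x] by (intro mult_left_mono) auto
    finally show "h * cmod (poly (pderiv p) (of_real x)) \<le> 1 / 2 * cmod (poly p (of_real x))" .
  qed auto
  also have "\<dots> \<le> 3 * (real k + 1) * (18 * M)\<^sup>2"
    using M by (intro mult_mono power_mono) (auto simp: h_def)
  also have "\<dots> = 972 * (M\<^sup>2 * (real k + 1))" by (simp add: power_mult_distrib)
  finally have 1: "real n \<le> real k + 972 * (M\<^sup>2 * (real k + 1))" by simp
  have "(1/2)\<^sup>2 \<le> M\<^sup>2" using M by (intro power_mono) auto
  hence "1 * (real k + 1) \<le> (4 * M\<^sup>2) * (real k + 1)"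
    by (intro mult_right_mono) (auto simp: power2_eq_square)
  hence "real k + 1 \<le> 4 * (M\<^sup>2 * (real k + 1))" by (simp only: mult.assoc mult_1)
  hence "real n \<le> 1024 * (M\<^sup>2 * (real k + 1))" using 1 by linarith
  hence "real n / (real k + 1) \<le> (32 * M)\<^sup>2"
    by (simp add: pos_divide_le_eq power_mult_distrib)
  hence "sqrt (real n / (real k + 1)) \<le> 32 * M" using M by (intro real_le_lsqrt) auto
  thus ?thesis by (simp add: M_def A_def B_def mult.commute)
qed

section \<open>Polynomials with a slow descent\<close>

text \<open>
  The full series has the sum \<open>(1 - t)\<^sup>-\<^sup>a\<^sup>-\<^sup>1\<close> and nonnegative terms.  The induction on \<open>a\<close> uses
  Pascal's rule: multiplication by \<open>1 - t\<close> lowers \<open>a\<close> by one, up to a boundary term of the right sign.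
\<close>

lemma negative_binomial_partial_sum_le:
  fixes t :: real
  assumes "0 \<le> t" "t \<le> 1"
  shows "(1 - t) ^ Suc a * (\<Sum>i<J. real ((a + i) choose i) * t ^ i) \<le> 1"
proof (induction a)
  case 0
  have "(1 - t) * (\<Sum>i<J. t ^ i) = 1 - t ^ J" by (simp add: one_diff_power_eq)
  thus ?case using assms by simp
next
  case (Suc a)
  have rec: "(1 - t) * (\<Sum>i<J. real ((Suc a + i) choose i) * t ^ i) \<le> (\<Sum>i<J. real ((a + i) choose i) * t ^ i)"
  proof -
    define d where "d N = (if N = 0 then 0 else real ((a + N) choose (N - 1)))" for N
    have pascal: "real ((Suc a + N) choose N) = real ((a + N) choose N) + d N" for N
      by (cases N) (simp_all add: d_def)
    have d_Suc: "d (Suc N) = real ((Suc a + N) choose N)" for N by (simp add: d_def)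
    have partial: "(1 - t) * (\<Sum>i<N. real ((Suc a + i) choose i) * t ^ i) + d N * t ^ N =
            (\<Sum>i<N. real ((a + i) choose i) * t ^ i)" for N
    proof (induction N)
      case 0
      show ?case by (simp add: d_def)
    next
      case (Suc N)
      show ?case
        unfolding sum.lessThan_Suc Suc.IH[symmetric] d_Suc pascal[of N] by (simp add: algebra_simps)
    qed
    have "d J * t ^ J \<ge> 0" using assms by (simp add: d_def)
    thus ?thesis unfolding partial[of J, symmetric] by simp
  qed
  have "(1 - t) ^ Suc (Suc a) * (\<Sum>i<J. real ((Suc a + i) choose i) * t ^ i) =
        (1 - t) ^ Suc a * ((1 - t) * (\<Sum>i<J. real ((Suc a + i) choose i) * t ^ i))"
    by (simp add: mult_ac)
  also have "\<dots> \<le> (1 - t) ^ Suc a * (\<Sum>i<J. real ((a + i) choose i) * t ^ i)"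
    using rec assms by (intro mult_left_mono) auto
  also have "\<dots> \<le> 1" by (rule Suc.IH)
  finally show ?case .
qed

lemma pderiv_sum: "pderiv (\<Sum>i\<in>I. f i) = (\<Sum>i\<in>I. pderiv (f i))"
  by (induction I rule: infinite_finite_induct) (simp_all add: pderiv_add)

lemma smult_of_nat: "smult (of_nat n) p = of_nat n * p"
  by (simp add: of_nat_poly)

text \<open>
  For \<open>y = x\<^sup>2\<close> in \<open>[0,1]\<close> this is the probability that at most \<open>j\<close> successes precede the
  \<open>(a+1)\<close>-st failure in independent trials with success probability \<open>y\<close>.  It is close to \<open>1\<close> for
  small \<open>y\<close> and drops to \<open>0\<close> around \<open>y = j / (a + j)\<close>.
\<close>

definition neg_binomial_poly :: "nat \<Rightarrow> nat \<Rightarrow> complex poly" where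
  "neg_binomial_poly a j = [:1, 0, -1:] ^ Suc a * (\<Sum>i\<le>j. of_nat ((a + i) choose i) * [:0, 0, 1:] ^ i)"

text \<open>
  The sum telescopes under differentiation, so only the last term survives: up to sign, the derivative with
  respect to \<open>y\<close> is the density of a beta distribution.
\<close>

lemma pderiv_neg_binomial_poly:
  "pderiv (neg_binomial_poly a j) =
     - (of_nat (Suc a) * of_nat ((Suc a + j) choose j) * [:0, 2:] * [:0, 0, 1:] ^ j * [:1, 0, -1:] ^ a)"
proof (induction j)
  case 0
  have "pderiv [:1, 0, -1:] = - [:0, 2 :: complex:]" by (simp add: pderiv_pCons)
  moreover have "neg_binomial_poly a 0 = [:1, 0, -1:] ^ Suc a"
    by (simp add: neg_binomial_poly_def)
  ultimately have "pderiv (neg_binomial_poly a 0) = of_nat (Suc a) * [:1, 0, -1:] ^ a * - [:0, 2:]"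
    by (simp only: pderiv_power_Suc smult_of_nat)
  thus ?case by (simp only: binomial_n_0 of_nat_1 power_0 mult_1_left mult_1_right mult_minus_left mult_minus_right mult_ac)
next
  case (Suc j)
  define y :: "complex poly" where "y = [:0, 0, 1:]"
  define w :: "complex poly" where "w = [:1, 0, -1:]"
  define x :: "complex poly" where "x = [:0, 2:]"
  define c1 :: "complex poly" where "c1 = of_nat ((Suc a + j) choose j)"
  define c2 :: "complex poly" where "c2 = of_nat ((a + Suc j) choose Suc j)"
  define c3 :: "complex poly" where "c3 = of_nat ((Suc a + Suc j) choose Suc j)"
  have dw: "pderiv w = - x" and dy: "pderiv y = x" and w: "w = 1 - y"
    by (simp_all add: w_def y_def x_def pderiv_pCons one_pCons)
  \<comment> \<open>The two absorption identities for binomial coefficients make the sum telescope.\<close>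
  have "Suc j * ((a + Suc j) choose Suc j) = Suc a * ((Suc a + j) choose j)"
    using binomial_absorption[of j "Suc a + j"] binomial_absorb_comp[of "Suc a + j" j] by simp
  hence e1: "of_nat (Suc j) * c2 = of_nat (Suc a) * c1"
    unfolding c1_def c2_def of_nat_mult[symmetric] by (simp only:)
  have "(Suc a + Suc j) * ((a + Suc j) choose Suc j) = Suc a * ((Suc a + Suc j) choose Suc j)"
    using binomial_absorb_comp[of "Suc a + Suc j" "Suc j"] by simp
  hence e2: "of_nat (Suc a + Suc j) * c2 = of_nat (Suc a) * c3"
    unfolding c3_def c2_def of_nat_mult[symmetric] by (simp only:)
  have "neg_binomial_poly a (Suc j) = neg_binomial_poly a j + c2 * (w ^ Suc a * y ^ Suc j)"
    unfolding neg_binomial_poly_def c2_def w_def[symmetric] y_def[symmetric]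
    by (simp only: sum.atMost_Suc distrib_left mult_ac)
  moreover have "pderiv (of_nat m * q) = of_nat m * pderiv q" for m and q :: "complex poly"
    by (simp add: pderiv_mult)
  hence "pderiv (c2 * q) = c2 * pderiv q" for q
    unfolding c2_def .
  moreover have "pderiv (w ^ Suc a * y ^ Suc j) =
      of_nat (Suc j) * (x * y ^ j * w ^ a) * w - of_nat (Suc a) * (x * y ^ j * w ^ a) * y"
    by (simp only: pderiv_mult pderiv_power_Suc dw dy smult_of_nat)
       (simp add: algebra_simps del: of_nat_Suc)
  moreover have factor: "- (A * c1 * x * y ^ j * w ^ a) + c2 * (B * (x * y ^ j * w ^ a) * w - A * (x * y ^ j * w ^ a) * y) =
      (x * y ^ j * w ^ a) * (B * c2 - A * c1 - ((A + B) * c2) * y)" for A B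
  proof -
    have "- (A * c1 * V) + c2 * (B * V * w - A * V * y) = V * (B * c2 - A * c1 - ((A + B) * c2) * y)" for V
      unfolding w by (simp add: algebra_simps)
    from this[of "x * y ^ j * w ^ a"] show ?thesis by (simp only: mult.assoc)
  qed
  ultimately have "pderiv (neg_binomial_poly a (Suc j)) =
      - (of_nat (Suc a) * c1 * x * y ^ j * w ^ a) +
      c2 * (of_nat (Suc j) * (x * y ^ j * w ^ a) * w - of_nat (Suc a) * (x * y ^ j * w ^ a) * y)"
    using Suc.IH by (simp only: pderiv_add of_nat_mult c1_def x_def y_def w_def)
  also have "\<dots> = (x * y ^ j * w ^ a) *
      (of_nat (Suc j) * c2 - of_nat (Suc a) * c1 - (of_nat (Suc a + Suc j) * c2) * y)"
    unfolding of_nat_add by (rule factor)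
  also have "\<dots> = - (of_nat (Suc a) * c3 * x * y ^ Suc j * w ^ a)"
    unfolding e1 e2 by (simp add: algebra_simps)
  finally show ?case
    by (simp only: of_nat_mult c3_def x_def y_def w_def)
qed

text \<open>
  A single polynomial of the family above drops too steeply, over a distance \<open>a\<^sup>-\<^sup>1\<^sup>/\<^sup>2\<close> in \<open>x\<close>.  The averaging
  spreads the drop over a distance of the order of \<open>(J / a)\<^sup>1\<^sup>/\<^sup>2\<close>.
\<close>

definition plateau_poly :: "nat \<Rightarrow> nat \<Rightarrow> complex poly" where
  "plateau_poly a J = smult (1 / of_nat J) (\<Sum>j<J. neg_binomial_poly a j)"

lemma poly_neg_binomial_poly:
  "poly (neg_binomial_poly a j) (of_real x) =
     of_real ((1 - x\<^sup>2) ^ Suc a * (\<Sum>i<Suc j. real ((a + i) choose i) * (x\<^sup>2) ^ i))"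
proof -
  have "poly [:1, 0, -1:] (complex_of_real x) = of_real (1 - x\<^sup>2)"
       "poly [:0, 0, 1:] (complex_of_real x) = of_real (x\<^sup>2)"
    by (simp_all add: power2_eq_square)
  thus ?thesis
    unfolding neg_binomial_poly_def poly_mult poly_power poly_sum
    by (simp add: lessThan_Suc_atMost del: poly_pCons power_Suc)
qed

lemma norm_plateau_poly_le:
  assumes "\<bar>x\<bar> \<le> 1"
  shows "cmod (poly (plateau_poly a J) (of_real x)) \<le> 1"
proof -
  have x: "x\<^sup>2 \<le> 1" using assms by (simp add: abs_square_le_1)
  have "cmod (poly (neg_binomial_poly a j) (of_real x)) \<le> 1" for j
  proof -
    have "0 \<le> (1 - x\<^sup>2) ^ Suc a * (\<Sum>i<Suc j. real ((a + i) choose i) * (x\<^sup>2) ^ i)"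
      using x by (intro mult_nonneg_nonneg sum_nonneg) auto
    thus ?thesis
      unfolding poly_neg_binomial_poly norm_of_real
      using x negative_binomial_partial_sum_le[of "x\<^sup>2" a "Suc j"] by (simp only: abs_of_nonneg) simp
  qed
  hence "cmod (\<Sum>j<J. poly (neg_binomial_poly a j) (of_real x)) \<le> (\<Sum>j<J. 1)"
    by (intro order_trans[OF norm_sum] sum_mono)
  thus ?thesis
    by (simp add: plateau_poly_def poly_sum norm_divide divide_le_eq)
qed

lemma poly_plateau_poly_0: "J > 0 \<Longrightarrow> poly (plateau_poly a J) 0 = 1"
  using poly_neg_binomial_poly[of a _ 0]
  by (simp add: plateau_poly_def poly_sum sum.lessThan_Suc_shift del: sum.lessThan_Suc)

text \<open>
  With \<open>t = x\<^sup>2\<close> and \<open>S\<close> the sum, \<open>(|x| S)\<^sup>2 = tS \<cdot> S\<close>.  For \<open>j < J \<le> b + 2\<close>, lowering the upper index of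
  the binomial coefficient by \<open>2\<close> costs at most a factor \<open>4\<close>, and then the partial sums of the negative
  binomial series give \<open>S \<le> 4\<close>.  In \<open>tS\<close> the factor \<open>t\<close> shifts the index, and absorption then gains a factor
  \<open>(j + 1) / (b + j + 1) \<le> J / (b + 1)\<close>.
\<close>

lemma negative_binomial_profile_le:
  fixes x :: real
  assumes x: "\<bar>x\<bar> \<le> 1" and J: "J \<le> b + 2"
  shows "\<bar>x\<bar> * (\<Sum>j<J. real ((b + 2 + j) choose j) * (x\<^sup>2) ^ j * (1 - x\<^sup>2) ^ Suc b) \<le> 4 * sqrt (real J / real (b + 1))"
proof -
  define t where "t = x\<^sup>2"
  have t: "0 \<le> t" "t \<le> 1" using x by (auto simp: t_def abs_square_le_1)
  define S where "S = (\<Sum>j<J. real ((b + 2 + j) choose j) * t ^ j * (1 - t) ^ Suc b)"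
  have S0: "S \<ge> 0" unfolding S_def using t by (intro sum_nonneg) auto
  have c4: "real ((b + 2 + j) choose j) \<le> 4 * real ((b + j) choose j)" if "j < J" for j
  proof -
    have 1: "(b + 2) * ((b + 2 + j) choose j) = (b + 2 + j) * ((b + 1 + j) choose j)"
      using binomial_absorb_comp[of "b + 2 + j" j] by simp
    have 2: "(b + 1) * ((b + 1 + j) choose j) = (b + 1 + j) * ((b + j) choose j)"
      using binomial_absorb_comp[of "b + 1 + j" j] by simp
    have "(b + 2) * (b + 1) * ((b + 2 + j) choose j) = (b + 1) * ((b + 2) * ((b + 2 + j) choose j))"
      by (simp only: mult_ac)
    also have "\<dots> = (b + 2 + j) * ((b + 1) * ((b + 1 + j) choose j))"
      unfolding 1 by (simp only: mult_ac)
    also have "\<dots> = (b + 2 + j) * (b + 1 + j) * ((b + j) choose j)"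
      unfolding 2 by (simp only: mult_ac)
    also have "\<dots> \<le> (2 * (b + 2)) * (2 * (b + 1)) * ((b + j) choose j)"
      using that J by (intro mult_mono) auto
    also have "\<dots> = (b + 2) * (b + 1) * (4 * ((b + j) choose j))" by simp
    finally have "(b + 2 + j) choose j \<le> 4 * ((b + j) choose j)"
      by (subst (asm) mult_le_cancel1) auto
    thus ?thesis by linarith
  qed
  have "S \<le> (\<Sum>j<J. 4 * ((1 - t) ^ Suc b * (real ((b + j) choose j) * t ^ j)))"
    unfolding S_def
  proof (rule sum_mono)
    fix j assume "j \<in> {..<J}"
    hence "real ((b + 2 + j) choose j) * (t ^ j * (1 - t) ^ Suc b) \<le>
             4 * real ((b + j) choose j) * (t ^ j * (1 - t) ^ Suc b)"
      using t by (intro mult_right_mono c4) auto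
    thus "real ((b + 2 + j) choose j) * t ^ j * (1 - t) ^ Suc b \<le>
            4 * ((1 - t) ^ Suc b * (real ((b + j) choose j) * t ^ j))"
      by (simp only: mult_ac)
  qed
  also have "\<dots> = 4 * ((1 - t) ^ Suc b * (\<Sum>j<J. real ((b + j) choose j) * t ^ j))"
    by (simp only: sum_distrib_left)
  also have "\<dots> \<le> 4 * 1" using t by (intro mult_left_mono negative_binomial_partial_sum_le) auto
  finally have S4: "S \<le> 4" by simp
  have "t * S \<le> (\<Sum>j<J. 4 * (real J / real (b + 1)) *
                   ((1 - t) ^ Suc b * (real ((b + Suc j) choose Suc j) * t ^ Suc j)))"
    unfolding S_def sum_distrib_left
  proof (rule sum_mono)
    fix j assume j: "j \<in> {..<J}"
    have "Suc j * ((b + Suc j) choose Suc j) = (b + Suc j) * ((b + j) choose j)"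
      using binomial_absorption[of j "b + Suc j"] by simp
    hence "real (b + Suc j) * real ((b + j) choose j) = real (Suc j) * real ((b + Suc j) choose Suc j)"
      by (metis of_nat_mult)
    moreover have "real (b + 1) * real ((b + j) choose j) \<le> real (b + Suc j) * real ((b + j) choose j)"
      by (intro mult_right_mono) auto
    moreover have "real (Suc j) * real ((b + Suc j) choose Suc j) \<le> real J * real ((b + Suc j) choose Suc j)"
      using j by (intro mult_right_mono) auto
    ultimately have "real (b + 1) * real ((b + j) choose j) \<le> real J * real ((b + Suc j) choose Suc j)"
      by linarith
    hence "real ((b + j) choose j) \<le> real J / real (b + 1) * real ((b + Suc j) choose Suc j)"
      by (simp add: field_simps del: binomial_Suc_Suc)
    hence "real ((b + 2 + j) choose j) \<le> 4 * (real J / real (b + 1)) * real ((b + Suc j) choose Suc j)"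
      using c4[of j] j by (simp del: binomial_Suc_Suc)
    hence "real ((b + 2 + j) choose j) * (t ^ Suc j * (1 - t) ^ Suc b) \<le>
             4 * (real J / real (b + 1)) * real ((b + Suc j) choose Suc j) * (t ^ Suc j * (1 - t) ^ Suc b)"
      using t by (intro mult_right_mono) auto
    thus "t * (real ((b + 2 + j) choose j) * t ^ j * (1 - t) ^ Suc b) \<le>
            4 * (real J / real (b + 1)) * ((1 - t) ^ Suc b * (real ((b + Suc j) choose Suc j) * t ^ Suc j))"
      by (simp only: mult_ac power_Suc)
  qed
  also have "\<dots> = 4 * (real J / real (b + 1)) *
                   ((1 - t) ^ Suc b * (\<Sum>j<J. real ((b + Suc j) choose Suc j) * t ^ Suc j))"
    by (simp only: sum_distrib_left)
  also have "\<dots> \<le> 4 * (real J / real (b + 1)) *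
                   ((1 - t) ^ Suc b * (\<Sum>j<Suc J. real ((b + j) choose j) * t ^ j))"
    using t by (intro mult_left_mono) (simp_all add: sum.lessThan_Suc_shift del: sum.lessThan_Suc binomial_Suc_Suc power_Suc)
  also have "\<dots> \<le> 4 * (real J / real (b + 1)) * 1"
    using t by (intro mult_left_mono negative_binomial_partial_sum_le) auto
  finally have tS: "t * S \<le> 4 * (real J / real (b + 1))" by simp
  have "(\<bar>x\<bar> * S)\<^sup>2 = (t * S) * S" by (simp add: t_def power2_eq_square)
  also have "\<dots> \<le> (4 * (real J / real (b + 1))) * 4"
    by (rule mult_mono[OF tS S4]) (use S0 in auto)
  finally have "(\<bar>x\<bar> * S)\<^sup>2 \<le> 16 * (real J / real (b + 1))" by simp
  hence "\<bar>x\<bar> * S \<le> sqrt (16 * (real J / real (b + 1)))" by (rule real_le_rsqrt)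
  also have "\<dots> = 4 * sqrt (real J / real (b + 1))" unfolding real_sqrt_mult by simp
  finally show ?thesis unfolding S_def t_def .
qed

lemma norm_pderiv_plateau_poly_le:
  assumes x: "\<bar>x\<bar> \<le> 1" and J: "0 < J" "J \<le> b + 2"
  shows "cmod (poly (pderiv (plateau_poly (Suc b) J)) (of_real x)) \<le> sqrt (128 * real (b + 2) / real J)"
proof -
  have x2: "x\<^sup>2 \<le> 1" using x by (simp add: abs_square_le_1)
  define S where "S = (\<Sum>j<J. real ((b + 2 + j) choose j) * (x\<^sup>2) ^ j * (1 - x\<^sup>2) ^ Suc b)"
  have S0: "S \<ge> 0" unfolding S_def using x2 by (intro sum_nonneg) auto
  have "poly (pderiv (neg_binomial_poly (Suc b) j)) (of_real x) =
          of_real (- 2 * real (b + 2) * x * (real ((b + 2 + j) choose j) * (x\<^sup>2) ^ j * (1 - x\<^sup>2) ^ Suc b))" for j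
  proof -
    have "poly [:1, 0, -1:] (complex_of_real x) = of_real (1 - x\<^sup>2)"
       "poly [:0, 0, 1:] (complex_of_real x) = of_real (x\<^sup>2)"
       "poly [:0, 2:] (complex_of_real x) = of_real (2 * x)"
      by (simp_all add: power2_eq_square)
    thus ?thesis
      unfolding pderiv_neg_binomial_poly poly_mult poly_power poly_minus
      by (simp add: mult_ac del: poly_pCons power_Suc of_nat_Suc)
  qed
  hence "poly (pderiv (plateau_poly (Suc b) J)) (of_real x) = 1 / of_nat J * (\<Sum>j<J.
          of_real (- 2 * real (b + 2) * x * (real ((b + 2 + j) choose j) * (x\<^sup>2) ^ j * (1 - x\<^sup>2) ^ Suc b)))"
    unfolding plateau_poly_def pderiv_smult pderiv_sum poly_smult poly_sum by (simp only:)
  also have "\<dots> = of_real (- 2 * real (b + 2) / real J * x * S)"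
    unfolding of_real_sum[symmetric] sum_distrib_left[symmetric] S_def[symmetric] by simp
  finally have "poly (pderiv (plateau_poly (Suc b) J)) (of_real x) =
    of_real (- 2 * real (b + 2) / real J * x * S)" .
  hence "cmod (poly (pderiv (plateau_poly (Suc b) J)) (of_real x)) = \<bar>- 2 * real (b + 2) / real J * x * S\<bar>"
    by (simp only: norm_of_real)
  also have "\<dots> = 2 * real (b + 2) / real J * (\<bar>x\<bar> * S)"
    using S0 by (simp add: abs_mult)
  also have "\<dots> \<le> 2 * real (b + 2) / real J * (4 * sqrt (real J / real (b + 1)))"
    using negative_binomial_profile_le[OF x J(2)] unfolding S_def by (intro mult_left_mono) auto
  also have "\<dots> \<le> sqrt (128 * real (b + 2) / real J)"
  proof (rule real_le_rsqrt)
    have sq: "(2 * B / r * (4 * sqrt (r / c)))\<^sup>2 = 64 * B / r * (B / c)" if "r > 0" "c > 0" for B r c :: real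
    proof -
      have "(2 * B / r * (4 * sqrt (r / c)))\<^sup>2 = 64 * (B / r)\<^sup>2 * (sqrt (r / c))\<^sup>2"
        by (simp add: power_mult_distrib power_divide)
      also have "(sqrt (r / c))\<^sup>2 = r / c" using that by simp
      also have "64 * (B / r)\<^sup>2 * (r / c) = 64 * B / r * (B / c)"
        using that by (simp add: power2_eq_square)
      finally show ?thesis .
    qed
    have "(2 * real (b + 2) / real J * (4 * sqrt (real J / real (b + 1))))\<^sup>2 =
            64 * real (b + 2) / real J * (real (b + 2) / real (b + 1))"
      using J by (intro sq) auto
    also have "\<dots> \<le> 64 * real (b + 2) / real J * 2"
      by (intro mult_left_mono) (auto simp: divide_le_eq)
    finally show "(2 * real (b + 2) / real J * (4 * sqrt (real J / real (b + 1))))\<^sup>2 \<le> 128 * real (b + 2) / real J"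
      by simp
  qed
  finally show ?thesis .
qed

section \<open>The upper bound\<close>

lemma size_zeros_in_upper_half_disk_ge:
  assumes p: "p = [:1, 0, -1:] ^ m * [:1, 1:] ^ e * q" and "p \<noteq> 0"
  shows "2 * m + e \<le> size {#z \<in># proots p. z \<in> upper_half_disk#}"
proof -
  have "[:1, 0, -1:] = smult (-1) ([:-1, 1:] * [:1, 1 :: complex:])" by simp
  hence "p = smult ((-1) ^ m) ([:-1, 1:] ^ m * ([:1, 1:] ^ (m + e) * q))"
    unfolding p by (simp only: smult_power power_mult_distrib power_add mult_ac) (simp add: mult_ac)
  moreover have "q \<noteq> 0" using assms by auto
  ultimately have "proots p = repeat_mset m {#1#} + (repeat_mset (m + e) {#-1#} + proots q)"
    by (simp add: proots_mult proots_power)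
  moreover have "filter_mset (\<lambda>z. z \<in> upper_half_disk) (repeat_mset i {#1#}) = repeat_mset i {#1#}"
    "filter_mset (\<lambda>z. z \<in> upper_half_disk) (repeat_mset i {#-1#}) = repeat_mset i {#-1#}" for i
    by (auto intro!: multiset_eqI simp: upper_half_disk_def)
  ultimately show ?thesis by (simp del: repeat_mset_replicate_mset)
qed

lemma sup_norm_le:
  assumes "\<And>x. \<bar>x\<bar> \<le> 1 \<Longrightarrow> cmod (poly p (of_real x)) \<le> C"
  shows "sup_norm unit_interval (poly p) \<le> C"
  unfolding sup_norm_def unit_interval_def by (rule cSUP_least) (auto intro!: assms simp: abs_le_iff)

lemma ratio_le:
  assumes "\<And>x. \<bar>x\<bar> \<le> 1 \<Longrightarrow> cmod (poly (pderiv p) (of_real x)) \<le> C"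
    and "z \<in> unit_interval" "cmod (poly p z) \<ge> 1"
  shows "sup_norm unit_interval (poly (pderiv p)) / sup_norm unit_interval (poly p) \<le> C"
proof -
  have "1 \<le> sup_norm unit_interval (poly p)"
    using norm_le_sup_norm[OF assms(2), of p] assms(3) by linarith
  moreover have "sup_norm unit_interval (poly (pderiv p)) \<le> C" using assms(1) by (rule sup_norm_le)
  moreover have "0 \<le> C" using order_trans[OF norm_ge_zero assms(1)[of 0]] by simp
  ultimately have "sup_norm unit_interval (poly (pderiv p)) / sup_norm unit_interval (poly p) \<le> C / 1"
    by (intro frac_le) auto
  thus ?thesis by simp
qed

text \<open>
  The plateau polynomial with \<open>J\<close> of the order of \<open>k\<close> has all but \<open>2(J - 1)\<close> of its zeros at \<open>\<plusminus>1\<close>,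
  the value \<open>1\<close> at \<open>0\<close> and a derivative of the order of \<open>(n / J)\<^sup>1\<^sup>/\<^sup>2\<close>.  Its degree is even; for odd \<open>n\<close> a
  further factor \<open>1 + x\<close> supplies the missing zero, at \<open>-1\<close>.  For small \<open>n\<close> the monomial \<open>x\<^sup>n\<close> suffices.
\<close>

lemma exists_small_ratio:
  assumes n: "n \<ge> 1" and k: "k \<le> n"
  shows "\<exists>p\<in>admissible n k. sup_norm unit_interval (poly (pderiv p)) / sup_norm unit_interval (poly p)
            \<le> 42 * sqrt (real n / (real k + 1))"
proof -
  define L where "L = sqrt (real n / (real k + 1))"
  have "(1 / 2)\<^sup>2 \<le> real n / (real k + 1)" using n k by (simp add: field_simps power2_eq_square)
  hence L: "1 / 2 \<le> L" unfolding L_def by (rule real_le_rsqrt)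
  show ?thesis
  proof (cases "n \<ge> 6")
    case False
    have "sup_norm unit_interval (poly (pderiv (monom 1 n))) / sup_norm unit_interval (poly (monom 1 n)) \<le> real n"
    proof (rule ratio_le[of _ _ 1])
      fix x :: real assume "\<bar>x\<bar> \<le> 1"
      hence "\<bar>x\<bar> ^ (n - 1) \<le> 1" by (intro power_le_one) auto
      thus "cmod (poly (pderiv (monom 1 n)) (of_real x)) \<le> real n"
        by (simp add: pderiv_monom poly_monom norm_mult norm_power mult_left_le)
    qed (auto simp: poly_monom unit_interval_def image_iff intro!: bexI[of _ 1])
    also have "\<dots> \<le> 42 * L" using False L by simp
    finally show ?thesis unfolding L_def using admissible_nonempty[OF n] by blast
  next
    case True
    define N where "N = n div 2"
    define e where "e = n mod 2"
    \<comment> \<open>The cap at half of \<open>N\<close> keeps \<open>J \<le> b + 2\<close>;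
      when it applies, \<open>k\<close> is of the order of \<open>n\<close> and \<open>J\<close> still of the order of \<open>k\<close>.\<close>
    define J where "J = min (k div 2 + 1) ((N + 1) div 2)"
    define b where "b = N - J - 1"
    have ne: "n = 2 * N + e" "e \<le> 1" by (auto simp: N_def e_def)
    have J: "0 < J" "J \<le> b + 2" "b + 2 + J = N + 1" "2 * (J - 1) \<le> k"
      using True ne by (auto simp: J_def b_def min_def)
    have kJ: "k + 1 \<le> 6 * J" using True ne k by (auto simp: J_def min_def)
    define Q where "Q = smult (1 / of_nat J)
      (\<Sum>j<J. \<Sum>i\<le>j. of_nat ((Suc b + i) choose i) * [:0, 0, 1 :: complex:] ^ i)"
    define p where "p = plateau_poly (Suc b) J * [:1, 1:] ^ e"
    have plateau: "plateau_poly (Suc b) J = [:1, 0, -1:] ^ (b + 2) * Q"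
      unfolding plateau_poly_def neg_binomial_poly_def Q_def sum_distrib_left[symmetric]
      by (simp add: mult_smult_right)
    have p0: "poly p 0 = 1"
      unfolding p_def poly_mult poly_plateau_poly_0[OF J(1)] by (simp add: poly_power)
    hence "p \<noteq> 0" by auto
    have "degree (of_nat ((Suc b + i) choose i) * [:0, 0, 1 :: complex:] ^ i) \<le> 2 * (J - 1)" if "i < J" for i
    proof -
      have "degree (of_nat ((Suc b + i) choose i) * [:0, 0, 1 :: complex:] ^ i) \<le> 0 + 2 * i"
        by (intro order_trans[OF degree_mult_le] add_mono order_trans[OF degree_power_le]) auto
      thus ?thesis using that by linarith
    qed
    hence dQ: "degree Q \<le> 2 * (J - 1)"
      unfolding Q_def by (intro order_trans[OF degree_smult_le] degree_sum_le) auto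
    have "degree p \<le> 2 * (b + 2) + 2 * (J - 1) + 1 * e"
      unfolding p_def plateau
      by (intro order_trans[OF degree_mult_le] add_mono dQ order_trans[OF degree_power_le]) auto
    also have "\<dots> = n" using J ne by simp
    finally have deg: "degree p \<le> n" .
    have "2 * (b + 2) + e \<le> size {#z \<in># proots p. z \<in> upper_half_disk#}"
      by (rule size_zeros_in_upper_half_disk_ge[where q = Q]) (use \<open>p \<noteq> 0\<close> in \<open>simp_all add: p_def plateau mult_ac\<close>)
    moreover have "n - k \<le> 2 * (b + 2) + e" using J ne by simp
    moreover have "poly p 1 = 0" by (simp add: p_def plateau)
    moreover have one: "1 \<in> unit_interval" "0 \<in> unit_interval"
      by (auto simp: unit_interval_def image_iff intro: bexI[of _ 1] bexI[of _ 0])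
    ultimately have "p \<in> admissible n k"
      using deg \<open>p \<noteq> 0\<close> by (auto simp: admissible_def polys_zeros_def polys_def)
    moreover have "sup_norm unit_interval (poly (pderiv p)) / sup_norm unit_interval (poly p) \<le> 42 * L"
    proof (rule ratio_le[of _ _ 0])
      fix x :: real assume x: "\<bar>x\<bar> \<le> 1"
      define P where "P = plateau_poly (Suc b) J"
      have "cmod (poly (pderiv P) (of_real x)) \<le> sqrt (128 * real (b + 2) / real J)"
        unfolding P_def using x J by (intro norm_pderiv_plateau_poly_le)
      also have "\<dots> \<le> sqrt (20\<^sup>2 * (real n / (real k + 1)))"
      proof (rule real_sqrt_le_mono)
        have "real (b + 2) / real J \<le> (real n / 2) / ((real k + 1) / 6)"
          using J kJ ne by (intro frac_le) auto
        hence "128 * (real (b + 2) / real J) \<le> 128 * ((real n / 2) / ((real k + 1) / 6))"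
          by (intro mult_left_mono) auto
        hence "128 * real (b + 2) / real J \<le> 384 * (real n / (real k + 1))"
          by (simp del: of_nat_add)
        also have "\<dots> \<le> 20\<^sup>2 * (real n / (real k + 1))" by (intro mult_right_mono) auto
        finally show "128 * real (b + 2) / real J \<le> 20\<^sup>2 * (real n / (real k + 1))" .
      qed
      also have "\<dots> = 20 * L" unfolding real_sqrt_mult L_def by simp
      finally have dP: "cmod (poly (pderiv P) (of_real x)) \<le> 20 * L" .
      have nP: "cmod (poly P (of_real x)) \<le> 1" unfolding P_def using x by (rule norm_plateau_poly_le)
      from ne consider "e = 0" | "e = 1" by linarith
      thus "cmod (poly (pderiv p) (of_real x)) \<le> 42 * L"
      proof cases
        case 1
        thus ?thesis using dP L by (simp add: p_def P_def)
      next
        case 2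
        have "cmod (poly (pderiv P) (of_real x) * of_real (1 + x)) \<le> 20 * L * 2"
          unfolding norm_mult norm_of_real by (rule mult_mono[OF dP]) (use x L in auto)
        note bound = order_trans[OF norm_triangle_ineq add_mono[OF nP this]]
        have "poly (pderiv p) (of_real x) = poly P (of_real x) + poly (pderiv P) (of_real x) * of_real (1 + x)"
          unfolding p_def P_def[symmetric] 2 by (simp add: pderiv_mult pderiv_pCons algebra_simps del: mult_pCons_left mult_pCons_right)
        also have "cmod \<dots> \<le> 1 + 20 * L * 2"
          by (rule bound)
        also have "\<dots> \<le> 42 * L" using L by simp
        finally show ?thesis .
      qed
    qed (use p0 one in auto)
    ultimately show ?thesis unfolding L_def by blast
  qed
qed

theorem theorem2p1:
  shows "\<exists>c1 c2 :: real. c1 > 0 \<and> c2 > 0 \<and>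
    (\<forall>n k :: nat. n \<ge> 1 \<and> k \<le> n \<longrightarrow>
      c1 * sqrt (real n / (real k + 1)) \<le>
        (INF p\<in>admissible n k.
           sup_norm unit_interval (poly (pderiv p)) / sup_norm unit_interval (poly p)) \<and>
      (INF p\<in>admissible n k.
           sup_norm unit_interval (poly (pderiv p)) / sup_norm unit_interval (poly p)) \<le>
        c2 * sqrt (real n / (real k + 1)))"
proof (rule exI[of _ "1 / 32"], rule exI[of _ 42], intro conjI allI impI)
  fix n k :: nat assume nk: "n \<ge> 1 \<and> k \<le> n"
  show "1 / 32 * sqrt (real n / (real k + 1)) \<le>
        (INF p\<in>admissible n k.
           sup_norm unit_interval (poly (pderiv p)) / sup_norm unit_interval (poly p))"
    using nk admissible_nonempty by (intro cINF_greatest Turan_lower_bound) auto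
  obtain p where p: "p \<in> admissible n k"
    "sup_norm unit_interval (poly (pderiv p)) / sup_norm unit_interval (poly p) \<le> 42 * sqrt (real n / (real k + 1))"
    using exists_small_ratio nk by blast
  show "(INF p\<in>admissible n k.
           sup_norm unit_interval (poly (pderiv p)) / sup_norm unit_interval (poly p)) \<le>
        42 * sqrt (real n / (real k + 1))"
    by (rule order_trans[OF cINF_lower[OF bdd_below_quotients p(1)] p(2)])
qed auto

end
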